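(* Let $\mathcal I$ be a discretely represented ideal on $\mathbb N$. Then there is a positive projection $Q\colon\ell_\infty\to\ell_\infty$ such that $\ker Q=c_{0,\mathcal I}$. Moreover, $Q$ can be chosen so that, setting $T(B)=\{n\in\mathbb N:Q(\chi_B)_n=1\}$ for each $B\subseteq\mathbb N$, the following properties hold: (1) $Q(\chi_A)=\chi_{T(A)}$ for all $A\subseteq\mathbb N$, and $Q(\chi_{\mathbb N})=\chi_{\mathbb N}$; (2) if $A\subseteq B$, then $T(A)\subseteq T(B)$; (3) $T(T(A))=T(A)$ for all $A\subseteq\mathbb N$; (4) $T(A\cap B)=T(A)\cap T(B)$ for all $A,B\subseteq\mathbb N$; (5) the family $\mathcal B=\{B\subseteq\mathbb N:T(B)=B\}$ is closed under arbitrary intersections; (6) if $\mathcal I$ is strongly $\omega$-maximal, then $Q$ has infinite rank.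
   Context: An ideal on $\mathbb N$ is a family of subsets of $\mathbb N$ containing $\emptyset$ and closed under subsets and finite unions; every ideal is assumed to contain all finite sets. A maximal ideal is a proper ideal whose only proper extension is $\mathcal P(\mathbb N)$. The dual filter of $\mathcal I$ is $\mathcal I^*=\{\mathbb N\setminus A:A\in\mathcal I\}$. For a positive integer $k$, $\mathcal I$ is $k$-maximal if it is the intersection of $k$ pairwise distinct maximal ideals (equivalently, $k$ is the least number of maximal ideals whose intersection is $\mathcal I$). $\mathcal I$ is strongly $\omega$-maximal if there is a countably infinite collection $\{\mathcal I_n:n\in\mathbb N\}$ of maximal ideals with $\mathcal I=\bigcap_n\mathcal I_n$ such that $\{\mathcal I_n^*:n\in\mathbb N\}$ is a discrete subspace of $\beta\mathbb N$ (the space of ultrafilters on $\mathbb N$). $\mathcal I$ is discretely represented if it is either $k$-maximal for some positive integer $k$ or strongly $\omega$-maximal. $\ell_\infty$ is the real Banach lattice of bounded real sequences with sup norm and coordinatewise order; $c_{0,\mathcal I}$ is the closed subspace of all $(x_n)\in\ell_\infty$ with $\{n:|x_n|\ge\varepsilon\}\in\mathcal I$ for every $\varepsilon>0$. A positive projection is a bounded linear $Q$ with $Q^2=Q$ and $Qx\ge0$ whenever $x\ge0$. $\chi_A$ is the characteristic function of $A$, and $x_n$ the $n$-th coordinate of $x$. *)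

theory Defs
  imports "HOL-Analysis.Analysis"
begin

section \<open>Ideals and ultrafilters on the natural numbers\<close>

definition is_ideal :: "nat set set \<Rightarrow> bool" where
  "is_ideal I \<longleftrightarrow>
     {} \<in> I \<and>
     (\<forall>A B. B \<in> I \<and> A \<subseteq> B \<longrightarrow> A \<in> I) \<and>
     (\<forall>A B. A \<in> I \<and> B \<in> I \<longrightarrow> A \<union> B \<in> I) \<and>
     (\<forall>F. finite F \<longrightarrow> F \<in> I)"

definition maximal_ideal :: "nat set set \<Rightarrow> bool" where
  "maximal_ideal I \<longleftrightarrow>
     is_ideal I \<and> I \<noteq> UNIV \<and> (\<forall>J. is_ideal J \<and> I \<subset> J \<longrightarrow> J = UNIV)"

definition dual_filter :: "nat set set \<Rightarrow> nat set set" where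
  "dual_filter I = {- A | A. A \<in> I}"

text \<open>The library type of filters admits the improper filter and encodes filters as
  quantifiers; here filters are families of sets, so that \<open>dual_filter\<close> can be compared
  with them directly. Principal ultrafilters are included.\<close>

definition proper_filter :: "nat set set \<Rightarrow> bool" where
  "proper_filter U \<longleftrightarrow>
     UNIV \<in> U \<and> {} \<notin> U \<and>
     (\<forall>A B. A \<in> U \<and> A \<subseteq> B \<longrightarrow> B \<in> U) \<and>
     (\<forall>A B. A \<in> U \<and> B \<in> U \<longrightarrow> A \<inter> B \<in> U)"

definition ultrafilter :: "nat set set \<Rightarrow> bool" where
  "ultrafilter U \<longleftrightarrow>
     proper_filter U \<and> (\<forall>V. proper_filter V \<and> U \<subseteq> V \<longrightarrow> V = U)"

text \<open>The space of all ultrafilters with the Stone topology, whose basic open sets are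
  the sets of ultrafilters containing a given \<open>A\<close>.\<close>

definition beta_nat :: "nat set set topology" where
  "beta_nat = topology_generated_by (range (\<lambda>A. {U. ultrafilter U \<and> A \<in> U}))"

lemma topspace_beta_nat: "topspace beta_nat = {U. ultrafilter U}"
  by (auto simp: beta_nat_def ultrafilter_def proper_filter_def)

definition k_maximal :: "nat \<Rightarrow> nat set set \<Rightarrow> bool" where
  "k_maximal k I \<longleftrightarrow>
     k > 0 \<and> (\<exists>\<M>. finite \<M> \<and> card \<M> = k \<and> (\<forall>J\<in>\<M>. maximal_ideal J) \<and> I = \<Inter>\<M>)"

definition strongly_omega_maximal :: "nat set set \<Rightarrow> bool" where
  "strongly_omega_maximal I \<longleftrightarrow>
     (\<exists>J :: nat \<Rightarrow> nat set set.
        inj J \<and> (\<forall>n. maximal_ideal (J n)) \<and> I = (\<Inter>n. J n) \<and>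
        subtopology beta_nat (range (\<lambda>n. dual_filter (J n)))
          = discrete_topology (range (\<lambda>n. dual_filter (J n))))"

definition discretely_represented :: "nat set set \<Rightarrow> bool" where
  "discretely_represented I \<longleftrightarrow> (\<exists>k. k_maximal k I) \<or> strongly_omega_maximal I"


section \<open>Bounded sequences\<close>

text \<open>Since \<open>nat\<close> carries the discrete topology, its bounded continuous functions are
  exactly the bounded sequences, and the library norm on them is the sup norm.\<close>

type_synonym linfty = "nat \<Rightarrow>\<^sub>C real"

lemma bcontfun_nat_iff: "f \<in> bcontfun \<longleftrightarrow> bounded (range f)" for f :: "nat \<Rightarrow> real"
  by (auto simp: bcontfun_def)

definition chi :: "nat set \<Rightarrow> linfty" where
  "chi A = Bcontfun (indicat_real A)"

lemma apply_chi [simp]: "apply_bcontfun (chi A) = indicat_real A"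
proof -
  have "indicat_real A \<in> bcontfun"
    unfolding bcontfun_nat_iff by (auto intro!: boundedI[where B = 1] simp: indicator_def)
  then show ?thesis by (simp add: chi_def Bcontfun_inverse)
qed

definition c0_ideal :: "nat set set \<Rightarrow> linfty set" where
  "c0_ideal I = {x. \<forall>\<epsilon>>0. {n. \<bar>apply_bcontfun x n\<bar> \<ge> \<epsilon>} \<in> I}"

definition nonneg_seq :: "linfty \<Rightarrow> bool" where
  "nonneg_seq x \<longleftrightarrow> (\<forall>n. 0 \<le> apply_bcontfun x n)"

definition positive_projection :: "(linfty \<Rightarrow> linfty) \<Rightarrow> bool" where
  "positive_projection Q \<longleftrightarrow>
     bounded_linear Q \<and> Q \<circ> Q = Q \<and> (\<forall>x. nonneg_seq x \<longrightarrow> nonneg_seq (Q x))"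

definition infinite_rank :: "(linfty \<Rightarrow> linfty) \<Rightarrow> bool" where
  "infinite_rank Q \<longleftrightarrow> \<not> (\<exists>S. finite S \<and> range Q \<subseteq> span S)"

end

theory Submission
  imports Defs
begin

text \<open>
  Write the ideal as the intersection of countably many maximal ideals. For finitely many distinct
  ultrafilters, and for a discrete sequence of ultrafilters, each of them contains a set
  that belongs to none of the others; because the family is countable these sets can be made
  disjoint by subtracting from each the earlier ones (\<open>ex_fibres_if_separated\<close>). Distributing
  the remaining integers arbitrarily gives a map \<open>p\<close> from \<open>\<nat>\<close> onto the family whose fibre over
  each ideal is large for the corresponding ultrafilter.

  The projection replaces \<open>x\<close> by the sequence whose value at \<open>n\<close> is the limit of \<open>x\<close> along
  the ultrafilter dual to \<open>p n\<close>. Its values are constant on the fibres of \<open>p\<close>, and each fibre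
  is large for its own ultrafilter, so taking the limits a second time changes nothing. The kernel
  consists of the sequences that tend to zero along every ultrafilter of the family, which is
  \<open>c\<^sub>0\<close> of the intersection. The limit of \<open>\<chi>\<^bsub>A\<^esub>\<close> along an ultrafilter is
  1 if the ultrafilter contains \<open>A\<close> and 0 otherwise, so \<open>Q\<close> maps \<open>\<chi>\<^bsub>A\<^esub>\<close> to the characteristic
  function of the union \<open>T A\<close> of those fibres whose ultrafilter contains \<open>A\<close>. Hence the fixed
  sets of \<open>T\<close> are exactly the unions of fibres, a family closed under arbitrary intersections.
  The characteristic functions of the fibres are linearly independent elements of the range, so
  the rank is infinite when the family is.
\<close>

section \<open>Limits along the dual of a maximal ideal\<close>

lemma is_idealD:
  assumes "is_ideal I"
  shows "{} \<in> I" "B \<in> I \<Longrightarrow> A \<subseteq> B \<Longrightarrow> A \<in> I" "A \<in> I \<Longrightarrow> B \<in> I \<Longrightarrow> A \<union> B \<in> I"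
    "finite F \<Longrightarrow> F \<in> I"
  using assms unfolding is_ideal_def by blast+

lemma maximal_ideal_is_ideal: "maximal_ideal I \<Longrightarrow> is_ideal I"
  by (simp add: maximal_ideal_def)

lemma maximal_ideal_UNIV_notin:
  assumes "maximal_ideal I"
  shows "UNIV \<notin> I"
  using assms unfolding maximal_ideal_def is_ideal_def by auto

text \<open>If \<open>A\<close> is not in \<open>I\<close>, then \<open>I\<close> and \<open>A\<close> generate the improper ideal, so \<open>\<nat>\<close> is
  the union of \<open>A\<close> and a member of \<open>I\<close>.\<close>

lemma maximal_ideal_Compl_iff:
  assumes "maximal_ideal I"
  shows "- A \<in> I \<longleftrightarrow> A \<notin> I"
proof
  have ideal: "is_ideal I" using assms by (rule maximal_ideal_is_ideal)
  show "A \<notin> I" if "- A \<in> I"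
    using is_idealD(3)[OF ideal, of "- A" A] that maximal_ideal_UNIV_notin[OF assms] by auto
  assume A: "A \<notin> I"
  define J where "J = {B. B - A \<in> I}"
  have "is_ideal J"
    unfolding is_ideal_def J_def
  proof (intro conjI allI impI; clarsimp)
    show "{} \<in> I" by (rule is_idealD(1)[OF ideal])
    show "B - A \<in> I" if "C - A \<in> I" "B \<subseteq> C" for B C
      by (rule is_idealD(2)[OF ideal that(1)]) (use that in blast)
    show "B \<union> C - A \<in> I" if "B - A \<in> I" "C - A \<in> I" for B C
      using is_idealD(3)[OF ideal that] by (simp add: Un_Diff)
    show "F - A \<in> I" if "finite F" for F
      using that by (intro is_idealD(4)[OF ideal]) auto
  qed
  moreover have "I \<subset> J"
  proof
    show "I \<subseteq> J" using is_idealD(2)[OF ideal] by (auto simp: J_def)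
    have "A \<in> J" by (simp add: J_def is_idealD(1)[OF ideal])
    then show "I \<noteq> J" using A by blast
  qed
  ultimately have "UNIV \<in> J" using assms unfolding maximal_ideal_def by blast
  then show "- A \<in> I" by (simp add: J_def Compl_eq_Diff_UNIV)
qed

text \<open>The dual filter as a filter of the library, which makes the calculus of limits available.\<close>

definition dual_limit_filter :: "nat set set \<Rightarrow> nat filter" where
  "dual_limit_filter I = Abs_filter (\<lambda>P. {n. \<not> P n} \<in> I)"

lemma eventually_dual_limit_filter:
  assumes "is_ideal I"
  shows "eventually P (dual_limit_filter I) \<longleftrightarrow> {n. \<not> P n} \<in> I"
  unfolding dual_limit_filter_def
proof (rule eventually_Abs_filter, rule is_filter.intro)
  show "{n. \<not> True} \<in> I" using is_idealD(1)[OF assms] by simp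
  fix P Q :: "nat \<Rightarrow> bool"
  show "{n. \<not> (P n \<and> Q n)} \<in> I" if "{n. \<not> P n} \<in> I" "{n. \<not> Q n} \<in> I"
    by (rule is_idealD(2)[OF assms is_idealD(3)[OF assms that]]) blast
  show "{n. \<not> Q n} \<in> I" if "\<forall>n. P n \<longrightarrow> Q n" "{n. \<not> P n} \<in> I"
    by (rule is_idealD(2)[OF assms that(2)]) (use that in blast)
qed

lemma dual_limit_filter_neq_bot:
  assumes "maximal_ideal I"
  shows "dual_limit_filter I \<noteq> bot"
  using assms
  by (simp add: trivial_limit_def eventually_dual_limit_filter maximal_ideal_is_ideal
      maximal_ideal_UNIV_notin)

text \<open>Compactness of a closed interval provides a cluster point, and a cluster point of an
  ultrafilter is a limit.\<close>

lemma bounded_tendsto_dual_limit_filter: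
  assumes I: "maximal_ideal I" and bound: "\<And>n. \<bar>f n\<bar> \<le> (c :: real)"
  shows "\<exists>l. (f \<longlongrightarrow> l) (dual_limit_filter I)"
proof -
  note ev = eventually_dual_limit_filter[OF maximal_ideal_is_ideal[OF I]]
  let ?F = "filtermap f (dual_limit_filter I)"
  have "?F \<noteq> bot"
    by (simp add: filtermap_bot_iff dual_limit_filter_neq_bot[OF I])
  moreover have "eventually (\<lambda>y. y \<in> {-c..c}) ?F"
    using bound by (auto simp: eventually_filtermap abs_le_iff minus_le_iff intro!: always_eventually)
  ultimately obtain l where l: "inf (nhds l) ?F \<noteq> bot"
    using compact_Icc[of "-c" c] unfolding compact_filter by blast
  have "(f \<longlongrightarrow> l) (dual_limit_filter I)"
  proof (rule topological_tendstoI, rule ccontr)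
    fix S assume S: "open S" "l \<in> S"
      and "\<not> eventually (\<lambda>n. f n \<in> S) (dual_limit_filter I)"
    then have "eventually (\<lambda>y. y \<notin> S) ?F"
      using maximal_ideal_Compl_iff[OF I, of "{n. f n \<in> S}"]
      by (simp add: eventually_filtermap ev Collect_neg_eq)
    moreover have "eventually (\<lambda>y. y \<in> S) (nhds l)"
      using S by (simp add: eventually_nhds_in_open)
    ultimately have "eventually (\<lambda>y. False) (inf (nhds l) ?F)"
      unfolding eventually_inf by (intro exI[of _ "\<lambda>y. y \<in> S"] exI[of _ "\<lambda>y. y \<notin> S"]) simp
    then show False using l by (simp add: trivial_limit_def)
  qed
  then show ?thesis ..
qed

definition ideal_lim :: "nat set set \<Rightarrow> linfty \<Rightarrow> real" where
  "ideal_lim I x = Lim (dual_limit_filter I) (apply_bcontfun x)"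

lemma abs_apply_bcontfun_le: "\<bar>apply_bcontfun x n\<bar> \<le> norm (x :: linfty)"
  using norm_bounded[of x n] by simp

lemma tendsto_ideal_lim:
  assumes "maximal_ideal I"
  shows "(apply_bcontfun x \<longlongrightarrow> ideal_lim I x) (dual_limit_filter I)"
proof -
  obtain l where l: "(apply_bcontfun x \<longlongrightarrow> l) (dual_limit_filter I)"
    using bounded_tendsto_dual_limit_filter[OF assms, of "apply_bcontfun x", OF abs_apply_bcontfun_le]
    by blast
  then show ?thesis
    using tendsto_Lim[OF dual_limit_filter_neq_bot[OF assms] l] by (simp add: ideal_lim_def)
qed

lemma ideal_lim_eqI:
  assumes "maximal_ideal I" "(apply_bcontfun x \<longlongrightarrow> l) (dual_limit_filter I)"
  shows "ideal_lim I x = l"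
  unfolding ideal_lim_def by (rule tendsto_Lim[OF dual_limit_filter_neq_bot[OF assms(1)] assms(2)])

lemma ideal_lim_add:
  assumes "maximal_ideal I"
  shows "ideal_lim I (x + y) = ideal_lim I x + ideal_lim I y"
proof (rule ideal_lim_eqI[OF assms])
  show "(apply_bcontfun (x + y) \<longlongrightarrow> ideal_lim I x + ideal_lim I y) (dual_limit_filter I)"
    using tendsto_add[OF tendsto_ideal_lim[OF assms, of x] tendsto_ideal_lim[OF assms, of y]]
    by simp
qed

lemma ideal_lim_scaleR:
  assumes "maximal_ideal I"
  shows "ideal_lim I (c *\<^sub>R x) = c * ideal_lim I x"
proof (rule ideal_lim_eqI[OF assms])
  show "(apply_bcontfun (c *\<^sub>R x) \<longlongrightarrow> c * ideal_lim I x) (dual_limit_filter I)"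
    using tendsto_mult_left[OF tendsto_ideal_lim[OF assms, of x], of c]
    by simp
qed

lemma ideal_lim_nonneg:
  assumes "maximal_ideal I" "nonneg_seq x"
  shows "0 \<le> ideal_lim I x"
  by (rule tendsto_lowerbound[OF tendsto_ideal_lim[OF assms(1), of x]])
    (use assms in \<open>simp_all add: nonneg_seq_def dual_limit_filter_neq_bot\<close>)

lemma abs_ideal_lim_le:
  assumes "maximal_ideal I"
  shows "\<bar>ideal_lim I x\<bar> \<le> norm x"
  by (rule tendsto_upperbound[OF tendsto_rabs[OF tendsto_ideal_lim[OF assms, of x]]])
    (simp_all add: abs_apply_bcontfun_le dual_limit_filter_neq_bot assms)

lemma ideal_lim_constant_on_large:
  assumes "maximal_ideal I" "- A \<in> I" "\<And>n. n \<in> A \<Longrightarrow> apply_bcontfun x n = c"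
  shows "ideal_lim I x = c"
proof (rule ideal_lim_eqI[OF assms(1)], rule tendsto_eventually)
  note ideal = maximal_ideal_is_ideal[OF assms(1)]
  show "eventually (\<lambda>n. apply_bcontfun x n = c) (dual_limit_filter I)"
    unfolding eventually_dual_limit_filter[OF ideal]
    by (rule is_idealD(2)[OF ideal assms(2)]) (use assms(3) in blast)
qed

lemma ideal_lim_chi:
  assumes "maximal_ideal I"
  shows "ideal_lim I (chi A) = (if - A \<in> I then 1 else 0)"
proof (cases "- A \<in> I")
  case True
  then show ?thesis using ideal_lim_constant_on_large[OF assms True, of "chi A" 1] by simp
next
  case False
  then have "- (- A) \<in> I" using maximal_ideal_Compl_iff[OF assms] by blast
  then show ?thesis
    using False ideal_lim_constant_on_large[OF assms, of "- A" "chi A" 0] by simp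
qed

lemma ideal_lim_eq_0_iff:
  assumes "maximal_ideal I"
  shows "ideal_lim I x = 0 \<longleftrightarrow> x \<in> c0_ideal I"
proof -
  have "ideal_lim I x = 0 \<longleftrightarrow> (apply_bcontfun x \<longlongrightarrow> 0) (dual_limit_filter I)"
    using ideal_lim_eqI[OF assms, of x 0] tendsto_ideal_lim[OF assms, of x] by auto
  then show ?thesis
    by (simp add: c0_ideal_def tendsto_iff not_less
        eventually_dual_limit_filter[OF maximal_ideal_is_ideal[OF assms]])
qed

section \<open>The projection attached to a family of ultrafilters with large fibres\<close>

locale fibred_maximal_ideals =
  fixes p :: "nat \<Rightarrow> nat set set"
  assumes maximal: "maximal_ideal (p n)"
    and fibre_large: "- {m. p m = p n} \<in> p n"
begin

definition fibre_projection :: "linfty \<Rightarrow> linfty" where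
  "fibre_projection x = Bcontfun (\<lambda>n. ideal_lim (p n) x)"

definition large_fibres :: "nat set \<Rightarrow> nat set" where
  "large_fibres A = {n. - A \<in> p n}"

lemma apply_fibre_projection [simp]:
  "apply_bcontfun (fibre_projection x) n = ideal_lim (p n) x"
proof -
  have "(\<lambda>n. ideal_lim (p n) x) \<in> bcontfun"
    unfolding bcontfun_nat_iff
    by (rule boundedI[where B = "norm x"]) (auto intro: abs_ideal_lim_le maximal)
  then show ?thesis by (simp add: fibre_projection_def Bcontfun_inverse)
qed

lemma positive_projection_fibre_projection: "positive_projection fibre_projection"
  unfolding positive_projection_def
proof (intro conjI allI impI)
  show "bounded_linear fibre_projection"
  proof (rule bounded_linear_intro[where K = 1])
    show "fibre_projection (x + y) = fibre_projection x + fibre_projection y" for x y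
      by (rule bcontfun_eqI) (simp add: ideal_lim_add maximal)
    show "fibre_projection (c *\<^sub>R x) = c *\<^sub>R fibre_projection x" for c x
      by (rule bcontfun_eqI) (simp add: ideal_lim_scaleR maximal)
    show "norm (fibre_projection x) \<le> norm x * 1" for x
      by (rule norm_bound) (simp add: abs_ideal_lim_le maximal)
  qed
  show "fibre_projection \<circ> fibre_projection = fibre_projection"
  proof (rule ext, rule bcontfun_eqI)
    fix x n
    have "ideal_lim (p n) (fibre_projection x) = ideal_lim (p n) x"
      by (rule ideal_lim_constant_on_large[OF maximal fibre_large]) simp
    then show "apply_bcontfun ((fibre_projection \<circ> fibre_projection) x) n
        = apply_bcontfun (fibre_projection x) n" by simp
  qed
  show "nonneg_seq (fibre_projection x)" if "nonneg_seq x" for x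
    using that by (simp add: nonneg_seq_def[of "fibre_projection x"] ideal_lim_nonneg maximal)
qed

lemma kernel_fibre_projection: "{x. fibre_projection x = 0} = c0_ideal (\<Inter>(range p))"
proof -
  have "fibre_projection x = 0 \<longleftrightarrow> (\<forall>n. ideal_lim (p n) x = 0)" for x
    by (metis apply_fibre_projection bcontfun_eqI zero_bcontfun.rep_eq)
  then show ?thesis
    by (auto simp: ideal_lim_eq_0_iff[OF maximal] c0_ideal_def)
qed

lemma fibre_projection_chi: "fibre_projection (chi A) = chi (large_fibres A)"
  by (rule bcontfun_eqI) (simp add: ideal_lim_chi[OF maximal] large_fibres_def)

lemma large_fibres_eq: "large_fibres B = {n. apply_bcontfun (fibre_projection (chi B)) n = 1}"
  by (simp add: ideal_lim_chi[OF maximal] large_fibres_def)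

lemma large_fibres_UNIV: "large_fibres UNIV = UNIV"
  by (simp add: large_fibres_def is_idealD(1)[OF maximal_ideal_is_ideal[OF maximal]])

lemma large_fibres_Int: "large_fibres (A \<inter> B) = large_fibres A \<inter> large_fibres B"
proof -
  have "- A \<union> - B \<in> p n \<longleftrightarrow> - A \<in> p n \<and> - B \<in> p n" for n
  proof -
    note ideal = maximal_ideal_is_ideal[OF maximal[of n]]
    show ?thesis
      using is_idealD(2)[OF ideal _ Un_upper1] is_idealD(2)[OF ideal _ Un_upper2]
        is_idealD(3)[OF ideal] by blast
  qed
  then show ?thesis by (auto simp: large_fibres_def)
qed

lemma large_fibres_mono: "A \<subseteq> B \<Longrightarrow> large_fibres A \<subseteq> large_fibres B"
  using large_fibres_Int[of A B] by (auto simp: Int_absorb2)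

text \<open>Whether \<open>n\<close> lies in \<open>large_fibres A\<close> depends on \<open>p n\<close> only, so this set is a union
  of fibres; a set containing the whole fibre of \<open>n\<close> is large for the ultrafilter of \<open>n\<close>.\<close>

lemma fibre_subset_imp_mem_large_fibres:
  assumes "{m. p m = p n} \<subseteq> A"
  shows "n \<in> large_fibres A"
proof -
  have "- A \<in> p n"
    by (rule is_idealD(2)[OF maximal_ideal_is_ideal[OF maximal] fibre_large]) (use assms in blast)
  then show ?thesis by (simp add: large_fibres_def)
qed

lemma mem_large_fibres_imp_fibre_subset:
  assumes "n \<in> large_fibres A"
  shows "{m. p m = p n} \<subseteq> large_fibres A"
  using assms by (auto simp: large_fibres_def)

lemma large_fibres_idem: "large_fibres (large_fibres A) = large_fibres A"
proof -
  have "chi (large_fibres (large_fibres A)) = chi (large_fibres A)"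
    using positive_projection_fibre_projection
    by (auto simp: positive_projection_def fun_eq_iff simp flip: fibre_projection_chi)
  then show ?thesis
    by (metis apply_chi indicator_eq_1_iff subsetI subset_antisym)
qed

lemma large_fibres_Inter:
  assumes "\<C> \<subseteq> {B. large_fibres B = B}"
  shows "large_fibres (\<Inter>\<C>) = \<Inter>\<C>"
proof
  show "large_fibres (\<Inter>\<C>) \<subseteq> \<Inter>\<C>"
    using assms large_fibres_mono[OF Inter_lower] by blast
  show "\<Inter>\<C> \<subseteq> large_fibres (\<Inter>\<C>)"
  proof
    fix n assume "n \<in> \<Inter>\<C>"
    then have "{m. p m = p n} \<subseteq> \<Inter>\<C>"
      using assms mem_large_fibres_imp_fibre_subset by blast
    then show "n \<in> large_fibres (\<Inter>\<C>)" by (rule fibre_subset_imp_mem_large_fibres)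
  qed
qed

lemma large_fibres_fibre: "large_fibres {m. p m = p n} = {m. p m = p n}"
proof
  show "{m. p m = p n} \<subseteq> large_fibres {m. p m = p n}"
    by (auto intro!: fibre_subset_imp_mem_large_fibres)
  show "large_fibres {m. p m = p n} \<subseteq> {m. p m = p n}"
  proof
    fix k assume "k \<in> large_fibres {m. p m = p n}"
    then have "- {m. p m = p n} \<in> p k" by (simp add: large_fibres_def)
    \<comment> \<open>The fibres over \<open>p k\<close> and \<open>p n\<close> are both large for \<open>p k\<close>, hence they meet.\<close>
    then have "- {m. p m = p n} \<union> - {m. p m = p k} \<noteq> UNIV"
      using is_idealD(3)[OF maximal_ideal_is_ideal[OF maximal] _ fibre_large[of k]]
        maximal_ideal_UNIV_notin[OF maximal[of k]] by force
    then show "k \<in> {m. p m = p n}" by auto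
  qed
qed

text \<open>A vanishing linear combination of characteristic functions of fibres is evaluated at a point
  of one fibre, where all the other functions vanish.\<close>

lemma independent_chi_fibres: "independent (range (\<lambda>n. chi {m. p m = p n}))"
proof -
  have "c (chi {m. p m = p n}) = 0"
    if t: "finite t" "t \<subseteq> range (\<lambda>n. chi {m. p m = p n})" "(\<Sum>v\<in>t. c v *\<^sub>R v) = 0"
      and n: "chi {m. p m = p n} \<in> t" for t c n
  proof -
    have other: "apply_bcontfun v n = 0" if v: "v \<in> t" "v \<noteq> chi {m. p m = p n}" for v
    proof -
      obtain k where "v = chi {m. p m = p k}" using v(1) t(2) by blast
      then show ?thesis using v(2) by (cases "p k = p n") auto
    qed
    have "0 = apply_bcontfun (\<Sum>v\<in>t. c v *\<^sub>R v) n" using t(3) by simp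
    also have "\<dots> = (\<Sum>v\<in>t. c v * apply_bcontfun v n)"
      by (induction t rule: infinite_finite_induct) simp_all
    also have "\<dots> = c (chi {m. p m = p n}) * apply_bcontfun (chi {m. p m = p n}) n"
      using other by (subst sum.remove[OF t(1) n]) simp
    finally show ?thesis by simp
  qed
  then show ?thesis unfolding independent_explicit_module by blast
qed

lemma infinite_rank_fibre_projection:
  assumes "infinite (range p)"
  shows "infinite_rank fibre_projection"
  unfolding infinite_rank_def
proof
  let ?V = "range (\<lambda>n. chi {m. p m = p n})"
  assume "\<exists>S. finite S \<and> range fibre_projection \<subseteq> span S"
  then obtain S where S: "finite S" "range fibre_projection \<subseteq> span S" by blast
  have "chi {m. p m = p n} \<in> range fibre_projection" for n
    using fibre_projection_chi[of "{m. p m = p n}"] by (metis large_fibres_fibre rangeI)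
  then have "finite ?V"
    using independent_span_bound[OF S(1) independent_chi_fibres] S(2) by blast
  moreover have "?V = (\<lambda>J. chi {m. p m = J}) ` range p" by auto
  moreover have "inj_on (\<lambda>J. chi {m. p m = J}) (range p)"
  proof (rule inj_onI, clarify)
    fix n k assume "chi {m. p m = p n} = chi {m. p m = p k}"
    then have "indicat_real {m. p m = p n} n = indicat_real {m. p m = p k} n"
      by (metis apply_chi)
    then show "p n = p k" by (simp add: indicator_def split: if_splits)
  qed
  ultimately show False using assms finite_imageD by metis
qed

end

section \<open>Separated families of maximal ideals\<close>

text \<open>This is discreteness of the family of dual ultrafilters, read off the basic open sets of the
  Stone topology: the set of ultrafilters containing \<open>A\<close> isolates the dual of \<open>J\<close>.\<close>

definition separated_ideals :: "nat set set set \<Rightarrow> bool" where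
  "separated_ideals \<M> \<longleftrightarrow> (\<forall>J\<in>\<M>. \<exists>A. - A \<in> J \<and> (\<forall>K\<in>\<M> - {J}. A \<in> K))"

text \<open>Two distinct maximal ideals are separated by a set, since neither contains the other; a
  finite intersection of such sets separates one ideal from finitely many.\<close>

lemma separated_ideals_if_finite:
  assumes "finite \<M>" "\<And>J. J \<in> \<M> \<Longrightarrow> maximal_ideal J"
  shows "separated_ideals \<M>"
  unfolding separated_ideals_def
proof
  fix J assume J: "J \<in> \<M>"
  note idealJ = maximal_ideal_is_ideal[OF assms(2)[OF J]]
  have "\<exists>A. - A \<in> J \<and> (\<forall>K\<in>\<N>. A \<in> K)" if "finite \<N>" "\<N> \<subseteq> \<M> - {J}" for \<N>
    using that
  proof (induction \<N> rule: finite_induct)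
    case empty
    have "- UNIV \<in> J" using is_idealD(1)[OF idealJ] by simp
    then show ?case by blast
  next
    case (insert K \<N>)
    then obtain A where A: "- A \<in> J" "\<forall>K\<in>\<N>. A \<in> K" by auto
    have K: "K \<in> \<M>" "K \<noteq> J" using insert.prems by auto
    have "\<not> J \<subseteq> K"
      using assms(2)[OF J] assms(2)[OF K(1)] K(2) unfolding maximal_ideal_def by blast
    then obtain C where C: "C \<in> J" "C \<notin> K" by blast
    have "- C \<in> K" using C(2) maximal_ideal_Compl_iff[OF assms(2)[OF K(1)]] by blast
    have "- (A \<inter> - C) \<in> J" using is_idealD(3)[OF idealJ A(1) C(1)] by simp
    moreover have "A \<inter> - C \<in> L" if "L \<in> insert K \<N>" for L
    proof -
      have L: "is_ideal L"
        using that insert.prems assms(2) by (auto intro!: maximal_ideal_is_ideal)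
      have "- C \<in> L \<or> A \<in> L" using that A(2) \<open>- C \<in> K\<close> by blast
      then show ?thesis
        using is_idealD(2)[OF L _ Int_lower1] is_idealD(2)[OF L _ Int_lower2] by blast
    qed
    ultimately show ?case by blast
  qed
  from this[of "\<M> - {J}"] show "\<exists>A. - A \<in> J \<and> (\<forall>K\<in>\<M> - {J}. A \<in> K)"
    using assms(1) by simp
qed

text \<open>The sets generating the topology of \<open>beta_nat\<close> are closed under finite intersections, since
  an ultrafilter contains \<open>A \<inter> B\<close> exactly when it contains \<open>A\<close> and \<open>B\<close>; so they form a base.\<close>

lemma openin_beta_nat_imp_basic:
  assumes "openin beta_nat W" "U \<in> W"
  shows "\<exists>A\<in>U. \<forall>V. ultrafilter V \<and> A \<in> V \<longrightarrow> V \<in> W"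
proof -
  have "generate_topology_on (range (\<lambda>A. {U. ultrafilter U \<and> A \<in> U})) W"
    using assms(1) by (simp add: beta_nat_def openin_topology_generated_by_iff)
  then show ?thesis using assms(2)
  proof (induction W)
    case (Int W W')
    then obtain A B where AB: "A \<in> U" "\<forall>V. ultrafilter V \<and> A \<in> V \<longrightarrow> V \<in> W"
      "B \<in> U" "\<forall>V. ultrafilter V \<and> B \<in> V \<longrightarrow> V \<in> W'" by blast
    have "openin beta_nat (W \<inter> W')"
      using Int.hyps unfolding beta_nat_def
      by (intro openin_Int) (simp_all add: openin_topology_generated_by_iff)
    then have "ultrafilter U"
      using Int.prems openin_subset topspace_beta_nat by blast
    then have "A \<inter> B \<in> U"
      using AB by (auto simp: ultrafilter_def proper_filter_def)
    moreover have "A \<in> V \<and> B \<in> V" if "ultrafilter V" "A \<inter> B \<in> V" for V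
      using that unfolding ultrafilter_def proper_filter_def by (meson Int_lower1 Int_lower2)
    ultimately show ?case using AB by (intro bexI[of _ "A \<inter> B"]) blast+
  next
    case (UN k)
    then show ?case by blast
  qed auto
qed

lemma mem_dual_filter_iff: "A \<in> dual_filter J \<longleftrightarrow> - A \<in> J"
  unfolding dual_filter_def by (auto intro: exI[of _ "- A"])

lemma separated_ideals_if_discrete:
  assumes "\<And>J. J \<in> \<M> \<Longrightarrow> maximal_ideal J"
    and discrete: "subtopology beta_nat (dual_filter ` \<M>) = discrete_topology (dual_filter ` \<M>)"
  shows "separated_ideals \<M>"
  unfolding separated_ideals_def
proof
  fix J assume J: "J \<in> \<M>"
  have "openin (subtopology beta_nat (dual_filter ` \<M>)) {dual_filter J}"
    using J unfolding discrete by simp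
  then obtain W where W: "openin beta_nat W" "{dual_filter J} = W \<inter> dual_filter ` \<M>"
    unfolding openin_subtopology by blast
  then obtain A where A: "A \<in> dual_filter J" "\<forall>V. ultrafilter V \<and> A \<in> V \<longrightarrow> V \<in> W"
    using openin_beta_nat_imp_basic[OF W(1), of "dual_filter J"] by blast
  have "topspace (subtopology beta_nat (dual_filter ` \<M>)) = dual_filter ` \<M>"
    unfolding discrete by simp
  then have ultra: "ultrafilter (dual_filter K)" if "K \<in> \<M>" for K
    using that by (auto simp: topspace_beta_nat)
  have "A \<in> K" if K: "K \<in> \<M>" "K \<noteq> J" for K
  proof (rule ccontr)
    assume "A \<notin> K"
    then have "A \<in> dual_filter K"
      using maximal_ideal_Compl_iff[OF assms(1)[OF K(1)]] by (simp add: mem_dual_filter_iff)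
    then have "dual_filter K \<in> W \<inter> dual_filter ` \<M>" using A(2) ultra K(1) by blast
    then have "dual_filter K = dual_filter J" using W(2) by blast
    then have "B \<in> K \<longleftrightarrow> B \<in> J" for B
      using mem_dual_filter_iff[of "- B" K] mem_dual_filter_iff[of "- B" J] by simp
    then show False using K(2) by blast
  qed
  then show "\<exists>A. - A \<in> J \<and> (\<forall>K\<in>\<M> - {J}. A \<in> K)"
    using A(1) by (auto simp: mem_dual_filter_iff)
qed

text \<open>Enumerate the family and send \<open>m\<close> to the first ideal whose separating set contains \<open>m\<close>,
  so that the fibre over an ideal contains its separating set minus finitely many sets from that
  ideal. A point outside all separating sets may go to any member, and goes to the first.\<close>

lemma ex_fibres_if_separated:
  assumes "countable \<M>" "\<M> \<noteq> {}" and maximal: "\<And>J. J \<in> \<M> \<Longrightarrow> maximal_ideal J"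
    and "separated_ideals \<M>"
  shows "\<exists>p. fibred_maximal_ideals p \<and> range p = \<M>"
proof -
  obtain A where A: "\<And>J. J \<in> \<M> \<Longrightarrow> - A J \<in> J" "\<And>J K. J \<in> \<M> \<Longrightarrow> K \<in> \<M> \<Longrightarrow> K \<noteq> J \<Longrightarrow> A J \<in> K"
    using \<open>separated_ideals \<M>\<close> unfolding separated_ideals_def by (metis Diff_iff singletonD)
  obtain e :: "nat \<Rightarrow> nat set set" where e: "range e = \<M>"
    using \<open>countable \<M>\<close> \<open>\<M> \<noteq> {}\<close> by (metis range_from_nat_into)
  \<comment> \<open>The second disjunct holds at index 0 for a point outside all separating sets.\<close>
  define p where "p m = e (LEAST i. m \<in> A (e i) \<or> (\<forall>j. m \<notin> A (e j)))" for m
  have p_in: "p m \<in> \<M>" for m using e by (auto simp: p_def)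
  have fibre: "- {m. p m = J} \<in> J" if J: "J \<in> \<M>" for J
  proof -
    note ideal = maximal_ideal_is_ideal[OF maximal[OF J]]
    obtain i where i: "e i = J" using J e by blast
    let ?B = "\<Union>j\<in>{j. j < i \<and> e j \<noteq> J}. A (e j)"
    have Union: "(\<Union>j\<in>N. A (e j)) \<in> J" if "finite N" "N \<subseteq> {j. e j \<noteq> J}" for N
      using that
    proof (induction N rule: finite_induct)
      case empty
      then show ?case using is_idealD(1)[OF ideal] by simp
    next
      case (insert j N)
      then have "A (e j) \<in> J" using A(2)[of "e j" J] J e by auto
      then show ?case using insert is_idealD(3)[OF ideal] by simp
    qed
    have "?B \<in> J" by (rule Union) auto
    then have "- A J \<union> ?B \<in> J" by (rule is_idealD(3)[OF ideal A(1)[OF J]])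
    moreover have "p m = J" if m: "m \<in> A J" "m \<notin> ?B" for m
    proof -
      let ?P = "\<lambda>i. m \<in> A (e i) \<or> (\<forall>j. m \<notin> A (e j))"
      have "?P i" using m i by simp
      then have "?P (Least ?P)" "Least ?P \<le> i" by (rule LeastI, rule Least_le)
      then have "m \<in> A (e (Least ?P))" "Least ?P < i \<or> Least ?P = i" using m(1) i by auto
      then show ?thesis using m(2) i by (auto simp: p_def)
    qed
    then have "- {m. p m = J} \<subseteq> - A J \<union> ?B" by auto
    ultimately show ?thesis by (rule is_idealD(2)[OF ideal])
  qed
  have "fibred_maximal_ideals p"
    by unfold_locales (use maximal p_in fibre in auto)
  moreover have "\<M> \<subseteq> range p"
  proof
    fix J assume J: "J \<in> \<M>"
    have "{m. p m = J} \<noteq> {}"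
      using fibre[OF J] maximal_ideal_UNIV_notin[OF maximal[OF J]] by force
    then show "J \<in> range p" by blast
  qed
  ultimately show ?thesis using p_in by blast
qed

text \<open>A representation by a discrete sequence takes precedence, so that the range of \<open>p\<close> is infinite
  whenever such a representation exists.\<close>

lemma discretely_represented_fibres:
  assumes "discretely_represented I"
  shows "\<exists>p. fibred_maximal_ideals p \<and> I = \<Inter>(range p) \<and>
    (strongly_omega_maximal I \<longrightarrow> infinite (range p))"
proof (cases "strongly_omega_maximal I")
  case True
  then obtain J :: "nat \<Rightarrow> nat set set" where J: "inj J" "\<forall>n. maximal_ideal (J n)" "I = (\<Inter>n. J n)"
    "subtopology beta_nat (range (\<lambda>n. dual_filter (J n)))
      = discrete_topology (range (\<lambda>n. dual_filter (J n)))"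
    unfolding strongly_omega_maximal_def by blast
  have "separated_ideals (range J)"
    using J by (intro separated_ideals_if_discrete) (auto simp: image_image)
  then obtain p where p: "fibred_maximal_ideals p" "range p = range J"
    using ex_fibres_if_separated[of "range J"] J(2) by auto
  have "infinite (range p)" using J(1) p(2) by (simp add: finite_image_iff)
  then show ?thesis using p J(3) by metis
next
  case False
  then obtain k where "k_maximal k I"
    using assms unfolding discretely_represented_def by blast
  then obtain \<M> where M: "finite \<M>" "\<M> \<noteq> {}" "\<forall>J\<in>\<M>. maximal_ideal J" "I = \<Inter>\<M>"
    unfolding k_maximal_def by fastforce
  have "separated_ideals \<M>" using M by (intro separated_ideals_if_finite) auto
  then obtain p where "fibred_maximal_ideals p" "range p = \<M>"
    using ex_fibres_if_separated[of \<M>] M by (auto simp: countable_finite)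
  then show ?thesis using M(4) False by blast
qed

section \<open>Discretely represented ideals\<close>

theorem theorem6p5:
  fixes I :: "nat set set"
  assumes "is_ideal I" and "discretely_represented I"
  shows "\<exists>(Q :: linfty \<Rightarrow> linfty) (T :: nat set \<Rightarrow> nat set).
    positive_projection Q \<and>
    {x. Q x = 0} = c0_ideal I \<and>
    (\<forall>B. T B = {n. apply_bcontfun (Q (chi B)) n = 1}) \<and>
    (\<forall>A. Q (chi A) = chi (T A)) \<and> Q (chi UNIV) = chi UNIV \<and>
    (\<forall>A B. A \<subseteq> B \<longrightarrow> T A \<subseteq> T B) \<and>
    (\<forall>A. T (T A) = T A) \<and>
    (\<forall>A B. T (A \<inter> B) = T A \<inter> T B) \<and>
    (\<forall>\<C>. \<C> \<subseteq> {B. T B = B} \<longrightarrow> \<Inter>\<C> \<in> {B. T B = B}) \<and>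
    (strongly_omega_maximal I \<longrightarrow> infinite_rank Q)"
proof -
  obtain p where p: "fibred_maximal_ideals p" "I = \<Inter>(range p)"
    "strongly_omega_maximal I \<longrightarrow> infinite (range p)"
    using discretely_represented_fibres[OF assms(2)] by blast
  interpret fibred_maximal_ideals p by (fact p(1))
  show ?thesis
  proof (intro exI[of _ fibre_projection] exI[of _ large_fibres] conjI allI impI)
    show "positive_projection fibre_projection" by (rule positive_projection_fibre_projection)
    show "{x. fibre_projection x = 0} = c0_ideal I"
      unfolding p(2) by (rule kernel_fibre_projection)
    show "fibre_projection (chi UNIV) = chi UNIV"
      by (simp add: fibre_projection_chi large_fibres_UNIV)
    show "infinite_rank fibre_projection" if "strongly_omega_maximal I"
      using p(3) that by (intro infinite_rank_fibre_projection) blast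
    show "large_fibres B = {n. apply_bcontfun (fibre_projection (chi B)) n = 1}" for B
      by (rule large_fibres_eq)
  qed (simp_all add: fibre_projection_chi large_fibres_mono large_fibres_idem large_fibres_Int
      large_fibres_Inter)
qed

end
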